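(* Let $r,q,a\in\mathbb{R}$, $\sigma>0$, $b>0$, $0\le R<1$, $0<T_1<T$, $V_b(t)=be^{-a(T-t)}$, and let $B(V,t)$ be the function \[ B(V,t)=Re^{-r(T-t)}+(1-R)e^{-r(T-t)}\left[N(d_1)-\left(\frac{V}{be^{-a(T-t)}}\right)^{1-\frac{2(r-q-a)}{\sigma^2}}N(d_2)\right], \] \[ d_1=\frac{\ln\frac{V}{b}+(r-q-\frac{\sigma^2}{2})(T-t)}{\sigma\sqrt{T-t}},\qquad d_2=\frac{\ln\frac{b}{V}+(r-q-2a-\frac{\sigma^2}{2})(T-t)}{\sigma\sqrt{T-t}}. \] Assume $e^{-r(T-T_1)}R<E<e^{-r(T-T_1)}$, and let $K\ge V_b(T_1)$ be the unique number such that $B(V,T_1)<E$ for $V<K$ and $B(V,T_1)\ge E$ for $V\ge K$. Then the solution $P(V,t)$ of the problem \[ \frac{\partial P}{\partial t}+\frac12\sigma^2V^2\frac{\partial^2P}{\partial V^2}+(r-q)V\frac{\partial P}{\partial V}-rP=0,\quad V>V_b(t),\ 0\le t<T_1, \] \[ P(V_b(t),t)=0,\ 0\le t<T_1,\qquad P(V,T_1)=(E-B(V,T_1))^+,\ V>V_b(T_1)=be^{-a(T-T_1)}, \] is given by \[ \begin{aligned} P(V,t)={}&\big[Ee^{-r(T_1-t)}-Re^{-r(T-t)}\big]\Big\{N(b_1)-N(b_2)-\Big(\tfrac{V}{be^{-a(T-t)}}\Big)^{\gamma}\big[N(\tilde b_1)-N(\tilde b_2)\big]\Big\}\\ &-(1-R)e^{-r(T-t)}\Big\{N_2(d,b_1;\rho)-N_2(d,b_2;\rho)-\Big(\tfrac{V}{be^{-a(T-t)}}\Big)^{\gamma}\big[N_2(\tilde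 d,\tilde b_1;\rho)-N_2(\tilde d,\tilde b_2;\rho)\big]\\ &\qquad+\big[N_2(d,-b_1;-\rho)-N_2(d,-b_5;-\rho)\big]-\Big(\tfrac{V}{be^{-a(T-t)}}\Big)^{\gamma}\big[N_2(\tilde d,-\tilde b_1;-\rho)-N_2(\tilde d,-\tilde b_5;-\rho)\big]\Big\}, \end{aligned} \] where $\gamma=1-2(r-q-a)/\sigma^2$, $\rho=\sqrt{(T_1-t)/(T-t)}$, and \[ b_1=\frac{\ln\frac{V}{be^{-a(T-t)}}+(r-q-a-\frac{\sigma^2}{2})(T_1-t)}{\sigma\sqrt{T_1-t}},\qquad b_2=\frac{\ln\frac{V}{K}+(r-q-\frac{\sigma^2}{2})(T_1-t)}{\sigma\sqrt{T_1-t}}, \] \[ \tilde b_1=\frac{\ln\frac{be^{-a(T-t)}}{V}+(r-q-a-\frac{\sigma^2}{2})(T_1-t)}{\sigma\sqrt{T_1-t}},\qquad \tilde b_2=\frac{\ln\Big(\frac{be^{-a(T-T_1)}}{K}\cdot\frac{be^{-a(T-t)}}{V}\Big)+(r-q-a-\frac{\sigma^2}{2})(T_1-t)}{\sigma\sqrt{T_1-t}}, \] \[ b_5=\frac{-\ln\Big(\frac{be^{-a(T-T_1)}}{K}\cdot\frac{be^{-a(T-t)}}{V}\Big)+(r-q-a-\frac{\sigma^2}{2})(T_1-t)}{\sigma\sqrt{T_1-t}},\qquad \tilde b_5=\frac{\ln\frac{K}{V}+(r-q-2a-\frac{\sigma^2}{2})(T_1-t)}{\sigma\sqrt{T_1-t}},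 \] \[ d=\frac{\ln\frac{V}{be^{-a(T-t)}}+(r-q-a-\frac{\sigma^2}{2})(T-t)}{\sigma\sqrt{T-t}},\qquad \tilde d=\frac{\ln\frac{be^{-a(T-t)}}{V}+(r-q-a-\frac{\sigma^2}{2})(T-t)}{\sigma\sqrt{T-t}}. \]
   Context: $N(x)=\frac{1}{\sqrt{2\pi}}\int_{-\infty}^{x}e^{-s^2/2}\,ds$ is the standard normal distribution function and $N_2(a_1,a_2;\rho)=\frac{1}{2\pi\sqrt{1-\rho^2}}\int_{-\infty}^{a_1}\int_{-\infty}^{a_2}\exp\!\big(-\frac{y_1^2-2\rho y_1y_2+y_2^2}{2(1-\rho^2)}\big)dy_2\,dy_1$ is the bivariate standard normal distribution function with correlation $\rho$. $x^+=\max(x,0)$. (Interpretation: $P$ is the price of a put option with maturity $T_1$ and strike $E$ on a zero-coupon credit bond with price $B$, knocked out at default $V\le V_b(t)$.) *)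

theory Defs
  imports "HOL-Analysis.Analysis"
begin

definition Nd :: "real \<Rightarrow> real" where
  "Nd x = (LBINT s:{..x}. exp (- s\<^sup>2 / 2)) / sqrt (2 * pi)"

definition N2 :: "real \<Rightarrow> real \<Rightarrow> real \<Rightarrow> real" where
  "N2 a1 a2 \<rho> = (LBINT y1:{..a1}. LBINT y2:{..a2}.
      exp (- (y1\<^sup>2 - 2 * \<rho> * y1 * y2 + y2\<^sup>2) / (2 * (1 - \<rho>\<^sup>2))))
     / (2 * pi * sqrt (1 - \<rho>\<^sup>2))"

definition pos_part :: "real \<Rightarrow> real" where
  "pos_part x = max x 0"

definition Vb :: "real \<Rightarrow> real \<Rightarrow> real \<Rightarrow> real \<Rightarrow> real" where
  "Vb a b T t = b * exp (- a * (T - t))"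

definition Bbond :: "real \<Rightarrow> real \<Rightarrow> real \<Rightarrow> real \<Rightarrow> real \<Rightarrow> real \<Rightarrow> real \<Rightarrow> real \<Rightarrow> real \<Rightarrow> real" where
  "Bbond r q a \<sigma> b R T V t =
    (let d1 = (ln (V / b) + (r - q - \<sigma>\<^sup>2 / 2) * (T - t)) / (\<sigma> * sqrt (T - t));
         d2 = (ln (b / V) + (r - q - 2 * a - \<sigma>\<^sup>2 / 2) * (T - t)) / (\<sigma> * sqrt (T - t))
     in R * exp (- r * (T - t)) + (1 - R) * exp (- r * (T - t)) *
        (Nd d1 - (V / (b * exp (- a * (T - t)))) powr (1 - 2 * (r - q - a) / \<sigma>\<^sup>2) * Nd d2))"

definition Pput :: "real \<Rightarrow> real \<Rightarrow> real \<Rightarrow> real \<Rightarrow> real \<Rightarrow> real \<Rightarrow> real \<Rightarrow> real \<Rightarrow> real \<Rightarrow> real \<Rightarrow> real \<Rightarrow> real \<Rightarrow> real" where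
  "Pput r q a \<sigma> b R T T1 E K V t =
    (let \<gamma> = 1 - 2 * (r - q - a) / \<sigma>\<^sup>2;
         \<rho> = sqrt ((T1 - t) / (T - t));
         vb = b * exp (- a * (T - t));
         vb1 = b * exp (- a * (T - T1));
         s1 = \<sigma> * sqrt (T1 - t);
         s = \<sigma> * sqrt (T - t);
         b1 = (ln (V / vb) + (r - q - a - \<sigma>\<^sup>2 / 2) * (T1 - t)) / s1;
         b2 = (ln (V / K) + (r - q - \<sigma>\<^sup>2 / 2) * (T1 - t)) / s1;
         tb1 = (ln (vb / V) + (r - q - a - \<sigma>\<^sup>2 / 2) * (T1 - t)) / s1;
         tb2 = (ln ((vb1 / K) * (vb / V)) + (r - q - a - \<sigma>\<^sup>2 / 2) * (T1 - t)) / s1;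
         b5 = (- ln ((vb1 / K) * (vb / V)) + (r - q - a - \<sigma>\<^sup>2 / 2) * (T1 - t)) / s1;
         tb5 = (ln (K / V) + (r - q - 2 * a - \<sigma>\<^sup>2 / 2) * (T1 - t)) / s1;
         d = (ln (V / vb) + (r - q - a - \<sigma>\<^sup>2 / 2) * (T - t)) / s;
         td = (ln (vb / V) + (r - q - a - \<sigma>\<^sup>2 / 2) * (T - t)) / s;
         w = (V / vb) powr \<gamma>
     in (E * exp (- r * (T1 - t)) - R * exp (- r * (T - t))) *
          (Nd b1 - Nd b2 - w * (Nd tb1 - Nd tb2))
        - (1 - R) * exp (- r * (T - t)) *
          (N2 d b1 \<rho> - N2 d b2 \<rho> - w * (N2 td tb1 \<rho> - N2 td tb2 \<rho>)
           + (N2 d (- b1) (- \<rho>) - N2 d (- b5) (- \<rho>))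
           - w * (N2 td (- tb1) (- \<rho>) - N2 td (- tb5) (- \<rho>))))"

end

theory Submission
  imports Defs "HOL-Probability.Distributions"
begin

text \<open>
  In the coordinate \<open>x = ln (V / V\<^sub>b(t))\<close> the barrier sits at \<open>x = 0\<close> and the Black--Scholes operator
  becomes that of a Brownian motion with drift \<open>\<mu> = r - q - a - \<sigma>\<^sup>2/2\<close> and volatility \<open>\<sigma>\<close>.
  Integrating out one variable of the bivariate normal distribution turns the closed formula into the
  integral of the drifted Gaussian kernel against a bounded function: the exercised payoff
  \<open>E - B\<close> on \<open>(0, k)\<close>, \<open>k = ln (K / V\<^sub>b(T\<^sub>1))\<close>, and its image \<open>y \<mapsto> - exp (\<gamma> y) (E - B)(- y)\<close> on \<open>(- k, 0)\<close>.
  Differentiation under the integral sign gives the equation, the antisymmetry under \<open>x \<mapsto> - x\<close>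
  gives the boundary value, and concentration of the Gaussian kernel gives the terminal value.
  At \<open>V = K\<close>, where the truncated payoff could jump, \<open>E - B\<close> vanishes by continuity.
\<close>

section \<open>The univariate and bivariate normal distribution functions\<close>

lemma Nd_eq_lebesgue_integral:
  "Nd x = (LINT s|lborel. indicator {..x} s * std_normal_density s)"
  by (simp add: Nd_def set_lebesgue_integral_def std_normal_density_def
      flip: integral_divide_zero)

text \<open>Standardisation \<open>y = m + s z\<close>; it evaluates the conditional law that
  appears once the bivariate density is factored.\<close>

lemma integral_normal_density_atMost:
  assumes "s > 0"
  shows "(LINT y|lborel. indicator {..a} y * normal_density m s y) = Nd ((a - m) / s)"
proof -
  have "(LINT y|lborel. indicator {..a} y * normal_density m s y)
      = \<bar>s\<bar> *\<^sub>R (LINT y|lborel. indicator {..a} (m + s * y) * normal_density m s (m + s * y))"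
    using assms by (intro lborel_integral_real_affine) auto
  also have "\<dots> = (LINT y|lborel. s * (indicator {..a} (m + s * y) * normal_density m s (m + s * y)))"
    using assms by simp
  also have "\<dots> = (LINT y|lborel. indicator {..(a - m) / s} y * std_normal_density y)"
  proof (intro Bochner_Integration.integral_cong refl)
    fix y
    have "s * normal_density m s (m + s * y) = std_normal_density y"
      using assms by (simp add: normal_density_def power_mult_distrib real_sqrt_mult)
    moreover have "indicator {..a} (m + s * y) = (indicator {..(a - m) / s} y :: real)"
      using assms by (simp add: indicator_def field_simps)
    ultimately show "s * (indicator {..a} (m + s * y) * normal_density m s (m + s * y))
        = indicator {..(a - m) / s} y * std_normal_density y"
      by (simp add: mult.left_commute)
  qed
  finally show ?thesis by (simp add: Nd_eq_lebesgue_integral)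
qed

lemma Nd_nonneg: "0 \<le> Nd x"
  unfolding Nd_eq_lebesgue_integral by (intro integral_nonneg_AE) auto

lemma Nd_le_1: "Nd x \<le> 1"
proof -
  have "integrable lborel (\<lambda>s. indicator {..x} s * std_normal_density s)"
    using integrable_real_mult_indicator[of "{..x}" lborel std_normal_density]
    by (simp add: mult.commute)
  then have "Nd x \<le> (LINT s|lborel. std_normal_density s)"
    unfolding Nd_eq_lebesgue_integral by (intro integral_mono) (auto simp: indicator_def)
  then show ?thesis by simp
qed

text \<open>The bridge from Lebesgue integrals over half-lines to gauge integrals over compact
  intervals, where substitution, reflection and the Leibniz rule are applied below. The endpoint
  \<open>a\<close> is a null set.\<close>

lemma integral_atMost_diff:
  fixes f :: "real \<Rightarrow> real"
  assumes "integrable lborel f" "a \<le> b" 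
  shows "(LINT y|lborel. indicator {..b} y * f y) - (LINT y|lborel. indicator {..a} y * f y)
    = integral {a..b} f"
proof -
  have int: "integrable lborel (\<lambda>y. indicator A y * f y)" if "A \<in> sets borel" for A
    using integrable_real_mult_indicator[OF _ assms(1), of A] that by (simp add: mult.commute)
  have "(LINT y|lborel. indicator {..b} y * f y) - (LINT y|lborel. indicator {..a} y * f y)
      = (LINT y|lborel. indicator {..b} y * f y - indicator {..a} y * f y)"
    by (subst Bochner_Integration.integral_diff) (auto intro: int)
  also have "\<dots> = (LINT y|lborel. indicator {a<..b} y * f y)"
    using assms(2) by (intro Bochner_Integration.integral_cong) (auto simp: indicator_def)
  also have "\<dots> = (LINT y|lborel. indicator {a..b} y * f y)"
  proof (rule integral_cong_AE)
    show "AE y in lborel. indicator {a<..b} y * f y = indicator {a..b} y * f y"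
      using AE_lborel_singleton[of a] by eventually_elim (auto simp: indicator_def)
  qed (use int in auto)
  also have "\<dots> = integral {a..b} f"
    using set_borel_integral_eq_integral(2)[of "{a..b}" f] int[of "{a..b}"]
    by (simp add: set_integrable_def set_lebesgue_integral_def)
  finally show ?thesis .
qed

lemma Nd_diff: "a \<le> b \<Longrightarrow> Nd b - Nd a = integral {a..b} std_normal_density"
  unfolding Nd_eq_lebesgue_integral by (rule integral_atMost_diff) simp_all

lemma continuous_on_normal_density [continuous_intros]:
  "continuous_on A f \<Longrightarrow> s \<noteq> 0 \<Longrightarrow> continuous_on A (\<lambda>x. normal_density m s (f x))"
  unfolding normal_density_def by (intro continuous_intros) auto

text \<open>The fundamental theorem of calculus on a compact interval around \<open>x\<close>, with
  \<open>Nd (x - 1)\<close> as anchor of the antiderivative. It supplies the continuity of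
  \<open>Nd\<close>.\<close>

lemma has_real_derivative_Nd: "(Nd has_real_derivative std_normal_density x) (at x)"
proof -
  have "((\<lambda>u. integral {x - 1..u} std_normal_density) has_real_derivative std_normal_density x)
      (at x within {x - 1..x + 1})"
    by (intro integral_has_real_derivative continuous_intros) auto
  then have "((\<lambda>u. integral {x - 1..u} std_normal_density) has_real_derivative std_normal_density x) (at x)"
    by (simp add: at_within_Icc_at)
  then have "((\<lambda>u. Nd (x - 1) + integral {x - 1..u} std_normal_density) has_real_derivative std_normal_density x) (at x)"
    by (auto intro!: derivative_eq_intros)
  then show ?thesis
  proof (rule has_field_derivative_transform_within_open[where S = "{x - 1<..}"])
    fix u assume "u \<in> {x - 1<..}"
    then show "Nd (x - 1) + integral {x - 1..u} std_normal_density = Nd u"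
      using Nd_diff[of "x - 1" u] by simp
  qed auto
qed

lemma isCont_Nd: "isCont Nd x"
  using has_real_derivative_Nd DERIV_isCont by blast

lemma continuous_on_Nd [continuous_intros]:
  "continuous_on A f \<Longrightarrow> continuous_on A (\<lambda>x. Nd (f x))"
  by (rule continuous_on_compose2[of UNIV Nd])
    (auto simp: isCont_Nd intro!: continuous_at_imp_continuous_on)

lemma borel_measurable_Nd [measurable]: "Nd \<in> borel_measurable borel"
  by (intro borel_measurable_continuous_onI continuous_intros)

lemma integrable_std_normal_density_Nd:
  assumes [measurable]: "f \<in> borel_measurable borel"
  shows "integrable lborel (\<lambda>y. std_normal_density y * Nd (f y))"
  by (rule Bochner_Integration.integrable_bound[of _ std_normal_density])
    (auto simp: abs_mult Nd_nonneg Nd_le_1 intro!: mult_left_le)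

section \<open>Integrating out one variable of the bivariate normal law\<close>

text \<open>Completing the square in \<open>y1\<close>: the joint density is the marginal of
  \<open>y2\<close> times the conditional density of \<open>y1\<close>, normal with mean
  \<open>\<rho> * y2\<close> and variance \<open>1 - \<rho>\<^sup>2\<close>.\<close>

lemma bivariate_density_factor:
  fixes \<rho> :: real
  assumes "\<bar>\<rho>\<bar> < 1"
  shows "exp (- (y1\<^sup>2 - 2 * \<rho> * y1 * y2 + y2\<^sup>2) / (2 * (1 - \<rho>\<^sup>2))) / (2 * pi * sqrt (1 - \<rho>\<^sup>2))
    = std_normal_density y2 * normal_density (\<rho> * y2) (sqrt (1 - \<rho>\<^sup>2)) y1"
proof -
  have pos: "1 - \<rho>\<^sup>2 > 0" using assms by (simp add: abs_square_less_1)
  have eq: "- (y1\<^sup>2 - 2 * \<rho> * y1 * y2 + y2\<^sup>2) / (2 * (1 - \<rho>\<^sup>2))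
      = - y2\<^sup>2 / 2 + - (y1 - \<rho> * y2)\<^sup>2 / (2 * (1 - \<rho>\<^sup>2))"
    using pos by (simp add: divide_simps) (simp add: power2_eq_square algebra_simps)
  have "sqrt (2 * pi) * sqrt (2 * pi * (1 - \<rho>\<^sup>2)) = 2 * pi * sqrt (1 - \<rho>\<^sup>2)"
    by (simp only: real_sqrt_mult[of "2 * pi"] mult.assoc[symmetric] real_sqrt_mult_self) simp
  then show ?thesis
    unfolding eq exp_add using pos by (simp add: normal_density_def)
qed

text \<open>The factor \<open>Nd\<close> is the conditional probability of
  \<open>y1 \<le> a1\<close>. The definition has \<open>y2\<close> as its inner variable, so Fubini
  is needed to integrate over \<open>y1\<close> first.\<close>

lemma N2_eq_lebesgue_integral:
  fixes \<rho> :: real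
  assumes "\<bar>\<rho>\<bar> < 1"
  shows "N2 a1 a2 \<rho> = (LINT y|lborel. indicator {..a2} y *
      (std_normal_density y * Nd ((a1 - \<rho> * y) / sqrt (1 - \<rho>\<^sup>2))))"
proof -
  define s where "s = sqrt (1 - \<rho>\<^sup>2)"
  have s: "s > 0" using assms by (simp add: s_def abs_square_less_1)
  define g where "g = (\<lambda>y2 y1. indicator {..a2} y2 * std_normal_density y2 *
      (indicator {..a1} y1 * normal_density (\<rho> * y2) s y1))"
  have [measurable]: "(\<lambda>x. g (fst x) (snd x)) \<in> borel_measurable (borel \<Otimes>\<^sub>M borel)"
    unfolding g_def normal_density_def by measurable
  have inner: "(LINT y1|lborel. g y2 y1)
      = indicator {..a2} y2 * (std_normal_density y2 * Nd ((a1 - \<rho> * y2) / s))" for y2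
    unfolding g_def using integral_normal_density_atMost[OF s, of a1 "\<rho> * y2"] by simp
  have int1: "integrable lborel (g y2)" for y2
    unfolding g_def
    using integrable_real_mult_indicator[of "{..a1}" lborel "normal_density (\<rho> * y2) s"] s
    by (intro integrable_mult_right) (simp add: mult.commute)
  \<comment> \<open>As \<open>g\<close> is nonnegative, its inner integral is also that of its norm,
    and it is dominated by the normal density in \<open>y2\<close>.\<close>
  have "integrable (lborel \<Otimes>\<^sub>M lborel) (\<lambda>(y2, y1). g y2 y1)"
  proof (rule lborel_pair.Fubini_integrable)
    have "g y2 y1 \<ge> 0" for y1 y2 by (simp add: g_def)
    then have "(\<lambda>y2. LINT y1|lborel. norm (case (y2, y1) of (y2, y1) \<Rightarrow> g y2 y1))
        = (\<lambda>y2. indicator {..a2} y2 * (std_normal_density y2 * Nd ((a1 - \<rho> * y2) / s)))"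
      by (simp add: inner)
    moreover have "integrable lborel (\<lambda>y2. (std_normal_density y2 * Nd ((a1 - \<rho> * y2) / s)) * indicator {..a2} y2)"
      by (intro integrable_real_mult_indicator integrable_std_normal_density_Nd) auto
    ultimately show "integrable lborel (\<lambda>y2. LINT y1|lborel. norm (case (y2, y1) of (y2, y1) \<Rightarrow> g y2 y1))"
      by (simp add: mult.commute)
  qed (use int1 in \<open>auto simp: case_prod_beta\<close>)
  note Fubini = lborel_pair.Fubini_integral[OF this]
  have "N2 a1 a2 \<rho> = (LINT y1|lborel. LINT y2|lborel. indicator {..a1} y1 * (indicator {..a2} y2 *
      (exp (- (y1\<^sup>2 - 2 * \<rho> * y1 * y2 + y2\<^sup>2) / (2 * (1 - \<rho>\<^sup>2))) / (2 * pi * sqrt (1 - \<rho>\<^sup>2)))))"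
    unfolding N2_def set_lebesgue_integral_def by simp
  also have "\<dots> = (LINT y1|lborel. LINT y2|lborel. g y2 y1)"
    unfolding bivariate_density_factor[OF assms] g_def s_def by (simp add: mult_ac)
  also have "\<dots> = (LINT y2|lborel. LINT y1|lborel. g y2 y1)"
    by (rule Fubini)
  finally show ?thesis by (simp add: inner s_def)
qed

text \<open>The bivariate terms of the closed formula come in pairs with a common first argument, so
  each pair is an integral over a compact interval.\<close>

lemma N2_diff:
  fixes \<rho> :: real
  assumes "\<bar>\<rho>\<bar> < 1" "b \<le> b'"
  shows "N2 d b' \<rho> - N2 d b \<rho>
    = integral {b..b'} (\<lambda>y. std_normal_density y * Nd ((d - \<rho> * y) / sqrt (1 - \<rho>\<^sup>2)))"
  unfolding N2_eq_lebesgue_integral[OF assms(1)]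
  using assms by (intro integral_atMost_diff integrable_std_normal_density_Nd) auto

section \<open>The Gaussian kernel\<close>

text \<open>Standardisation with reversed orientation: the arguments in the closed formula have the
  shape \<open>(m - y) / s\<close>, decreasing in the endpoint \<open>y\<close>.\<close>

lemma integral_std_normal_density_affine:
  fixes f :: "real \<Rightarrow> real"
  assumes "s > 0" "\<alpha> \<le> \<beta>" "continuous_on {\<alpha>..\<beta>} f"
  shows "integral {(m - \<beta>) / s..(m - \<alpha>) / s} (\<lambda>y. std_normal_density y * f (m - s * y))
    = integral {\<alpha>..\<beta>} (\<lambda>y. normal_density m s y * f y)"
proof -
  define h where "h = (\<lambda>y. normal_density m s y * f y)"
  define g where "g = (\<lambda>y. m + s * y)"
  have ends: "g ((\<alpha> - m) / s) = \<alpha>" "g ((\<beta> - m) / s) = \<beta>"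
    using assms by (auto simp: g_def)
  have le: "(\<alpha> - m) / s \<le> (\<beta> - m) / s"
    using assms by (simp add: divide_right_mono)
  have sub: "g ` {(\<alpha> - m) / s..(\<beta> - m) / s} \<subseteq> {\<alpha>..\<beta>}"
    using assms by (auto simp: g_def field_simps)
  \<comment> \<open>The substitution is made along the increasing map \<open>g\<close>; reflecting
    the variable afterwards reverses the orientation.\<close>
  have "((\<lambda>y. s *\<^sub>R h (g y)) has_integral
      integral {g ((\<alpha> - m) / s)..g ((\<beta> - m) / s)} h) {(\<alpha> - m) / s..(\<beta> - m) / s}"
  proof (rule has_integral_substitution[OF le _ sub])
    show "continuous_on {\<alpha>..\<beta>} h"
      unfolding h_def using assms by (intro continuous_intros) auto
    show "(g has_real_derivative s) (at y within A)" for y A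
      unfolding g_def by (auto intro!: derivative_eq_intros)
  qed (use assms ends in simp)
  then have "((\<lambda>y. s *\<^sub>R h (g y)) has_integral integral {\<alpha>..\<beta>} h) {(\<alpha> - m) / s..(\<beta> - m) / s}"
    by (simp only: ends)
  moreover have "s *\<^sub>R h (g y) = std_normal_density (- y) * f (m - s * (- y))" for y
    using assms(1) by (simp add: h_def g_def normal_density_def power_mult_distrib real_sqrt_mult)
  ultimately have "integral {(\<alpha> - m) / s..(\<beta> - m) / s} (\<lambda>y. std_normal_density (- y) * f (m - s * (- y)))
      = integral {\<alpha>..\<beta>} h"
    by (simp add: integral_unique)
  moreover have "{(\<alpha> - m) / s..(\<beta> - m) / s} = {- ((m - \<alpha>) / s)..- ((m - \<beta>) / s)}"
    using assms(1) by (simp add: field_simps)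
  ultimately show ?thesis
    using Henstock_Kurzweil_Integration.integral_reflect_real[of "(m - \<alpha>) / s" "(m - \<beta>) / s" "\<lambda>y. std_normal_density y * f (m - s * y)"]
    by (simp add: h_def)
qed

text \<open>The exponent \<open>-2\<mu>/\<sigma>\<^sup>2\<close> is exactly the one for which the image of the drifted Gaussian
  kernel under the reflection of its starting point is again a multiple of the kernel.\<close>
lemma normal_density_reflect:
  fixes \<mu> \<sigma> \<tau> :: real
  assumes "\<sigma> > 0" "\<tau> > 0"
  shows "exp (- 2 * \<mu> / \<sigma>\<^sup>2 * x) * normal_density (- x + \<mu> * \<tau>) (\<sigma> * sqrt \<tau>) (- y)
    = exp (- 2 * \<mu> / \<sigma>\<^sup>2 * y) * normal_density (x + \<mu> * \<tau>) (\<sigma> * sqrt \<tau>) y"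
proof -
  have "- 2 * \<mu> / \<sigma>\<^sup>2 * x + - (- y - (- x + \<mu> * \<tau>))\<^sup>2 / (2 * (\<sigma>\<^sup>2 * \<tau>))
      = - 2 * \<mu> / \<sigma>\<^sup>2 * y + - (y - (x + \<mu> * \<tau>))\<^sup>2 / (2 * (\<sigma>\<^sup>2 * \<tau>))"
    using assms by (simp add: divide_simps) (simp add: power2_eq_square algebra_simps)
  then have e: "exp (- 2 * \<mu> / \<sigma>\<^sup>2 * x) * exp (- (- y - (- x + \<mu> * \<tau>))\<^sup>2 / (2 * (\<sigma>\<^sup>2 * \<tau>)))
      = exp (- 2 * \<mu> / \<sigma>\<^sup>2 * y) * exp (- (y - (x + \<mu> * \<tau>))\<^sup>2 / (2 * (\<sigma>\<^sup>2 * \<tau>)))"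
    by (simp only: exp_add[symmetric])
  have sq: "(\<sigma> * sqrt \<tau>)\<^sup>2 = \<sigma>\<^sup>2 * \<tau>"
    using assms by (simp add: power_mult_distrib)
  have "e1 * (c * e2) = e3 * (c * e4)" if "e1 * e2 = e3 * e4" for c e1 e2 e3 e4 :: real
    using that by (metis mult.left_commute)
  from this[OF e] show ?thesis
    unfolding normal_density_def sq .
qed

section \<open>Concentration of the kernel as its deviation tends to zero\<close>

text \<open>Standardising moves mean and deviation into the argument of \<open>W\<close>; dominated
  convergence, with \<open>C\<close> times the normal density as majorant, then combines with
  continuity at the single point \<open>x\<close>.\<close>

lemma normal_density_integral_tendsto:
  fixes W :: "real \<Rightarrow> real" and m s :: "nat \<Rightarrow> real"
  assumes [measurable]: "W \<in> borel_measurable borel" and bdd: "\<And>y. \<bar>W y\<bar> \<le> C"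
    and cont: "isCont W x" and m: "m \<longlonglongrightarrow> x" and s: "s \<longlonglongrightarrow> 0" "\<And>i. s i > 0"
  shows "(\<lambda>i. LINT y|lborel. normal_density (m i) (s i) y * W y) \<longlonglongrightarrow> W x"
proof -
  have eq: "(LINT y|lborel. normal_density (m i) (s i) y * W y)
      = (LINT z|lborel. std_normal_density z * W (m i + s i * z))" for i
  proof -
    have "s i * normal_density (m i) (s i) (m i + s i * z) = std_normal_density z" for z
      using s(2)[of i] by (simp add: normal_density_def power_mult_distrib real_sqrt_mult)
    then have "(LINT z|lborel. s i * (normal_density (m i) (s i) (m i + s i * z) * W (m i + s i * z)))
        = (LINT z|lborel. std_normal_density z * W (m i + s i * z))"
      by (simp only: mult.assoc[symmetric])
    then show ?thesis
      using lborel_integral_real_affine[of "s i" "\<lambda>y. normal_density (m i) (s i) y * W y" "m i"] s(2)[of i]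
      by simp
  qed
  have "(\<lambda>i. LINT z|lborel. std_normal_density z * W (m i + s i * z))
      \<longlonglongrightarrow> (LINT z|lborel. std_normal_density z * W x)"
  proof (rule integral_dominated_convergence[where w = "\<lambda>z. std_normal_density z * C"])
    show "AE z in lborel. (\<lambda>i. std_normal_density z * W (m i + s i * z)) \<longlonglongrightarrow> std_normal_density z * W x"
    proof (intro AE_I2 tendsto_intros isCont_tendsto_compose[OF cont])
      fix z show "(\<lambda>i. m i + s i * z) \<longlonglongrightarrow> x"
        using tendsto_add[OF m tendsto_mult_left_zero[OF s(1), of z]] by simp
    qed
  qed (auto simp: abs_mult bdd intro!: mult_left_mono)
  then show ?thesis by (simp add: eq)
qed

text \<open>Truncation can create a jump only at an endpoint, and \<open>f x = 0\<close> removes it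
  there. This handles the terminal condition at \<open>V = K\<close>.\<close>

lemma isCont_indicator_mult:
  fixes f :: "real \<Rightarrow> real"
  assumes cont: "isCont f x" and endpt: "x \<in> {\<alpha>, \<beta>} \<Longrightarrow> f x = 0"
  shows "isCont (\<lambda>y. indicator {\<alpha>..\<beta>} y * f y) x"
proof (cases "x \<in> {\<alpha>, \<beta>}")
  case True
  then have "f x = 0" by (rule endpt)
  then have "(f \<longlongrightarrow> 0) (at x)" using cont by (simp add: isCont_def)
  then have lim: "((\<lambda>y. \<bar>f y\<bar>) \<longlongrightarrow> 0) (at x)"
    by (rule tendsto_rabs_zero)
  have "((\<lambda>y. indicator {\<alpha>..\<beta>} y * f y) \<longlongrightarrow> 0) (at x)"
    by (rule Lim_null_comparison[OF _ lim]) (auto simp: indicator_def)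
  then show ?thesis using \<open>f x = 0\<close> by (simp add: isCont_def)
next
  case False
  \<comment> \<open>Off the endpoints the truncated function agrees near \<open>x\<close> either
    with \<open>f\<close> or with zero.\<close>
  have "\<forall>\<^sub>F y in nhds x. (if x \<in> {\<alpha><..<\<beta>} then f y else 0) = indicator {\<alpha>..\<beta>} y * f y"
  proof (cases "x \<in> {\<alpha><..<\<beta>}")
    case True
    then have "\<forall>\<^sub>F y in nhds x. y \<in> {\<alpha><..<\<beta>}" by (intro eventually_nhds_in_open) auto
    then show ?thesis by eventually_elim (use True in auto)
  next
    case out: False
    then have "\<forall>\<^sub>F y in nhds x. y \<in> - {\<alpha>..\<beta>}" using False by (intro eventually_nhds_in_open) auto
    then show ?thesis by eventually_elim (use out in auto)
  qed
  moreover have "isCont (\<lambda>y. if x \<in> {\<alpha><..<\<beta>} then f y else 0) x"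
    using cont by (cases "x \<in> {\<alpha><..<\<beta>}") auto
  ultimately show ?thesis by (simp add: isCont_cong)
qed

text \<open>The truncation of \<open>f\<close> is bounded by compactness and continuous at
  \<open>x\<close>. Mean and deviation are arbitrary sequences, so that the terminal point can be
  approached jointly in price and time.\<close>

lemma normal_density_Icc_integral_tendsto:
  fixes f :: "real \<Rightarrow> real" and m s :: "nat \<Rightarrow> real"
  assumes cont: "continuous_on UNIV f" and endpt: "x \<in> {\<alpha>, \<beta>} \<Longrightarrow> f x = 0"
    and m: "m \<longlonglongrightarrow> x" and s: "s \<longlonglongrightarrow> 0" "\<And>i. s i > 0"
  shows "(\<lambda>i. integral {\<alpha>..\<beta>} (\<lambda>y. normal_density (m i) (s i) y * f y))
    \<longlonglongrightarrow> indicator {\<alpha>..\<beta>} x * f x"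
proof -
  have [measurable]: "f \<in> borel_measurable borel"
    using cont by (rule borel_measurable_continuous_onI)
  have "bounded (f ` {\<alpha>..\<beta>})"
    using cont by (intro compact_imp_bounded compact_continuous_image) (auto intro: continuous_on_subset)
  then obtain C where C: "\<forall>y\<in>{\<alpha>..\<beta>}. \<bar>f y\<bar> \<le> C" "C > 0"
    by (auto simp: bounded_pos)
  have "(\<lambda>i. LINT y|lborel. normal_density (m i) (s i) y * (indicator {\<alpha>..\<beta>} y * f y))
      \<longlonglongrightarrow> indicator {\<alpha>..\<beta>} x * f x"
  proof (rule normal_density_integral_tendsto[OF _ _ isCont_indicator_mult m s])
    show "\<bar>indicator {\<alpha>..\<beta>} y * f y\<bar> \<le> C" for y
      using C by (auto simp: indicator_def)
    show "isCont f x" using cont by (simp add: continuous_on_eq_continuous_at)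
  qed (use endpt in auto)
  moreover have "(LINT y|lborel. normal_density (m i) (s i) y * (indicator {\<alpha>..\<beta>} y * f y))
      = integral {\<alpha>..\<beta>} (\<lambda>y. normal_density (m i) (s i) y * f y)" for i
  proof -
    have "set_integrable lborel {\<alpha>..\<beta>} (\<lambda>y. normal_density (m i) (s i) y * f y)"
      using s(2)[of i] cont
      by (intro borel_integrable_atLeastAtMost' continuous_intros) (auto intro: continuous_on_subset)
    from set_borel_integral_eq_integral(2)[OF this] show ?thesis
      by (simp add: set_lebesgue_integral_def mult.left_commute)
  qed
  ultimately show ?thesis by simp
qed

section \<open>The Black--Scholes kernel\<close>

text \<open>The logarithm of the discounted transition density of the log price, \<open>y\<close>
  being its value at time \<open>T\<close>. Working with the logarithm makes every derivative a
  multiple of the kernel.\<close>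

definition bs_log_kernel :: "real \<Rightarrow> real \<Rightarrow> real \<Rightarrow> real \<Rightarrow> real \<Rightarrow> real \<Rightarrow> real \<Rightarrow> real" where
  "bs_log_kernel r q \<sigma> T y V t = - r * (T - t)
    - (y - ln V - (r - q - \<sigma>\<^sup>2 / 2) * (T - t))\<^sup>2 / (2 * (\<sigma>\<^sup>2 * (T - t))) - ln (T - t) / 2 - ln (sqrt (2 * pi) * \<sigma>)"

text \<open>The derivative of \<open>bs_log_kernel\<close> with respect to \<open>ln V\<close>. The
  derivatives of the kernel in \<open>V\<close> are, up to powers of \<open>V\<close>, the kernel
  times polynomials in it.\<close>

definition bs_score :: "real \<Rightarrow> real \<Rightarrow> real \<Rightarrow> real \<Rightarrow> real \<Rightarrow> real \<Rightarrow> real \<Rightarrow> real" where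
  "bs_score r q \<sigma> T y V t = (y - ln V - (r - q - \<sigma>\<^sup>2 / 2) * (T - t)) / (\<sigma>\<^sup>2 * (T - t))"

definition bs_kernel :: "real \<Rightarrow> real \<Rightarrow> real \<Rightarrow> real \<Rightarrow> real \<Rightarrow> real \<Rightarrow> real \<Rightarrow> real" where
  "bs_kernel r q \<sigma> T y V t = exp (bs_log_kernel r q \<sigma> T y V t)"

lemma bs_kernel_eq_normal_density:
  assumes "\<sigma> > 0" "t < T"
  shows "bs_kernel r q \<sigma> T y V t = exp (- r * (T - t)) *
    normal_density (ln V + (r - q - \<sigma>\<^sup>2 / 2) * (T - t)) (\<sigma> * sqrt (T - t)) y"
proof -
  define m where "m = (r - q - \<sigma>\<^sup>2 / 2) * (T - t)"
  define \<tau> where "\<tau> = T - t"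
  have \<tau>: "\<tau> > 0" using assms by (simp add: \<tau>_def)
  have "exp (ln \<tau> / 2) = sqrt \<tau>"
    using \<tau> by (simp add: ln_sqrt[symmetric])
  moreover have "exp (ln (sqrt (2 * pi) * \<sigma>)) = sqrt (2 * pi) * \<sigma>"
    using assms by (intro exp_ln) simp
  ultimately have "exp (- r * \<tau> - (y - ln V - m)\<^sup>2 / (2 * (\<sigma>\<^sup>2 * \<tau>)) - ln \<tau> / 2 - ln (sqrt (2 * pi) * \<sigma>))
      = exp (- r * \<tau>) * exp (- ((y - ln V - m)\<^sup>2 / (2 * (\<sigma>\<^sup>2 * \<tau>)))) / sqrt \<tau> / (sqrt (2 * pi) * \<sigma>)"
    by (simp only: exp_diff exp_minus divide_inverse)
  moreover have "sqrt (2 * pi * (\<sigma> * sqrt \<tau>)\<^sup>2) = sqrt \<tau> * (sqrt (2 * pi) * \<sigma>)"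
    using assms \<tau> by (simp add: real_sqrt_mult)
  moreover have "(\<sigma> * sqrt \<tau>)\<^sup>2 = \<sigma>\<^sup>2 * \<tau>" using \<tau> by (simp add: power_mult_distrib)
  ultimately show ?thesis
    unfolding bs_kernel_def bs_log_kernel_def normal_density_def m_def[symmetric]
    unfolding \<tau>_def[symmetric] by (simp add: diff_diff_eq)
qed

section \<open>Derivatives of the kernel and the Black-Scholes equation\<close>

lemma bs_score_has_derivative_V:
  assumes "V > 0"
  shows "((\<lambda>v. bs_score r q \<sigma> T y v t) has_real_derivative - 1 / (\<sigma>\<^sup>2 * (T - t)) / V) (at V)"
proof -
  have "((\<lambda>v. y - ln v - c) has_real_derivative - 1 / V) (at V)" for c
    using assms by (auto intro!: derivative_eq_intros)
  from DERIV_cdivide[OF this, of _ "\<sigma>\<^sup>2 * (T - t)"] show ?thesis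
    unfolding bs_score_def divide_divide_eq_left by (simp only: mult.commute)
qed

lemma bs_kernel_has_derivative_V:
  assumes "\<sigma> > 0" "t < T" "V > 0"
  shows "((\<lambda>v. bs_kernel r q \<sigma> T y v t) has_real_derivative
    bs_kernel r q \<sigma> T y V t * bs_score r q \<sigma> T y V t / V) (at V)"
proof -
  have "((\<lambda>v. A - (y - ln v - c)\<^sup>2 / (2 * D) - A' - A'') has_real_derivative (y - ln V - c) / D / V) (at V)"
    if "D \<noteq> 0" for A A' A'' c D
    apply (rule derivative_eq_intros refl | use assms that in simp; fail)+
    using assms that by (simp add: field_simps)
  then have "((\<lambda>v. bs_log_kernel r q \<sigma> T y v t) has_real_derivative bs_score r q \<sigma> T y V t / V) (at V)"
    unfolding bs_log_kernel_def bs_score_def using assms by simp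
  from DERIV_fun_exp[OF this] show ?thesis by (simp add: bs_kernel_def)
qed

lemma bs_kernel_has_derivative_VV:
  assumes "\<sigma> > 0" "t < T" "V > 0"
  shows "((\<lambda>v. bs_kernel r q \<sigma> T y v t * bs_score r q \<sigma> T y v t / v) has_real_derivative
    bs_kernel r q \<sigma> T y V t *
      ((bs_score r q \<sigma> T y V t)\<^sup>2 - bs_score r q \<sigma> T y V t - 1 / (\<sigma>\<^sup>2 * (T - t))) / V\<^sup>2) (at V)"
proof -
  have alg: "((k * s / V * s + - (e / V) * k) * V - k * s * 1) / (V * V) = k * (s\<^sup>2 - s - e) / V\<^sup>2" for k s e
    using assms(3) by (simp add: field_simps power2_eq_square)
  have "V \<noteq> 0" using assms(3) by simp
  from DERIV_divide[OF DERIV_mult[OF bs_kernel_has_derivative_V[OF assms, of r q y]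
          bs_score_has_derivative_V[OF assms(3), of r q \<sigma> T y t]] DERIV_ident this]
  show ?thesis unfolding minus_divide_left[symmetric] alg .
qed

lemma bs_kernel_has_derivative_t:
  assumes "\<sigma> > 0" "t < T"
  shows "((\<lambda>t. bs_kernel r q \<sigma> T y V t) has_real_derivative
    bs_kernel r q \<sigma> T y V t * (r + 1 / (2 * (T - t)) - (r - q - \<sigma>\<^sup>2 / 2) * bs_score r q \<sigma> T y V t
      - \<sigma>\<^sup>2 / 2 * (bs_score r q \<sigma> T y V t)\<^sup>2)) (at t)"
proof -
  \<comment> \<open>The derivative is taken in the time to maturity; composing with
    \<open>T - t\<close> then flips its sign. Here \<open>D\<close> stands for the squared
    volatility.\<close>
  have der: "((\<lambda>\<tau>. - r * \<tau> - (c - m * \<tau>)\<^sup>2 / (2 * (D * \<tau>)) - ln \<tau> / 2 - A) has_real_derivative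
      - (r + 1 / (2 * \<tau>) - m * ((c - m * \<tau>) / (D * \<tau>)) - D / 2 * ((c - m * \<tau>) / (D * \<tau>))\<^sup>2)) (at \<tau>)"
    if "\<tau> > 0" "D > 0" for c m D A \<tau> :: real
  proof -
    have alg: "- r - (2 * (- m * w) * (2 * (D * \<tau>)) - w\<^sup>2 * (D * 2)) / (2 * (D * \<tau>) * (2 * (D * \<tau>))) - 1 / \<tau> * 2 / (2 * 2)
       = - (r + 1 / (2 * \<tau>) - m * (w / (D * \<tau>)) - D / 2 * (w / (D * \<tau>))\<^sup>2)" for w
      using that by (simp add: field_simps power2_eq_square)
    show ?thesis
      unfolding alg[symmetric]
      by (rule derivative_eq_intros refl | use that in simp; fail)+
  qed
  have "((\<lambda>t. T - t) has_real_derivative - 1) (at t)"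
    by (auto intro!: derivative_eq_intros)
  from DERIV_chain2[OF der this, of "\<sigma>\<^sup>2" "y - ln V" "r - q - \<sigma>\<^sup>2 / 2" "ln (sqrt (2 * pi) * \<sigma>)"]
  have "((\<lambda>t. bs_log_kernel r q \<sigma> T y V t) has_real_derivative
      r + 1 / (2 * (T - t)) - (r - q - \<sigma>\<^sup>2 / 2) * bs_score r q \<sigma> T y V t
      - \<sigma>\<^sup>2 / 2 * (bs_score r q \<sigma> T y V t)\<^sup>2) (at t)"
    unfolding bs_log_kernel_def bs_score_def using assms by simp
  from DERIV_fun_exp[OF this] show ?thesis by (simp add: bs_kernel_def)
qed

text \<open>For each fixed \<open>y\<close> the kernel solves the equation, and the Leibniz rule
  passes this to the integral. \<open>FV\<close> is a function of all positive \<open>v\<close> so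
  that it can be differentiated again; \<open>c\<close> will translate log-distances from the
  barrier into log prices.\<close>

lemma bs_kernel_integral_solves:
  fixes f :: "real \<Rightarrow> real" and r q \<sigma> T c \<alpha> \<beta> :: real
  assumes \<sigma>: "\<sigma> > 0" and f: "continuous_on UNIV f" and V: "V > 0" and t: "t < T"
  defines "F \<equiv> \<lambda>V t. integral {\<alpha>..\<beta>} (\<lambda>y. bs_kernel r q \<sigma> T (y + c) V t * f y)"
  shows "\<exists>Ft FV FVV. ((\<lambda>s. F V s) has_real_derivative Ft) (at t) \<and>
    (\<forall>v>0. ((\<lambda>v. F v t) has_real_derivative FV v) (at v)) \<and>
    (FV has_real_derivative FVV) (at V) \<and>
    Ft + 1/2 * \<sigma>\<^sup>2 * V\<^sup>2 * FVV + (r - q) * V * FV V - r * F V t = 0"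
proof -
  define k where "k = (\<lambda>v t y. bs_kernel r q \<sigma> T (y + c) v t)"
  define z where "z = (\<lambda>v t y. bs_score r q \<sigma> T (y + c) v t)"
  define ft where "ft = (\<lambda>s y. k V s y * (r + 1 / (2 * (T - s)) - (r - q - \<sigma>\<^sup>2 / 2) * z V s y
      - \<sigma>\<^sup>2 / 2 * (z V s y)\<^sup>2) * f y)"
  define fV where "fV = (\<lambda>v y. k v t y * z v t y / v * f y)"
  define fVV where "fVV = (\<lambda>v y. k v t y * ((z v t y)\<^sup>2 - z v t y - 1 / (\<sigma>\<^sup>2 * (T - t))) / v\<^sup>2 * f y)"
  have k_eq: "F v s = integral {\<alpha>..\<beta>} (\<lambda>y. k v s y * f y)" for v s
    by (simp add: F_def k_def)
  note cf = continuous_on_compose2[OF f]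
  have cont_y: "continuous_on A (\<lambda>y. k v s y)" "continuous_on A (\<lambda>y. z v s y)" if "v > 0" "s < T" for A v s
    unfolding k_def z_def bs_kernel_def bs_log_kernel_def bs_score_def using that \<sigma>
    by (auto intro!: continuous_intros)
  \<comment> \<open>The parameter ranges are convex, as the Leibniz rule requires, and open, so that
    derivatives within them are ordinary derivatives.\<close>
  have cont_t: "continuous_on ({..<T} \<times> cbox \<alpha> \<beta>) (\<lambda>(s, y). ft s y)"
    unfolding ft_def k_def z_def bs_kernel_def bs_log_kernel_def bs_score_def case_prod_beta using \<sigma>
    by (intro continuous_intros cf) auto
  have cont_V: "continuous_on ({0<..} \<times> cbox \<alpha> \<beta>) (\<lambda>(v, y). fV v y)"
    and cont_VV: "continuous_on ({0<..} \<times> cbox \<alpha> \<beta>) (\<lambda>(v, y). fVV v y)"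
    unfolding fV_def fVV_def k_def z_def bs_kernel_def bs_log_kernel_def bs_score_def case_prod_beta using \<sigma> t
    by (intro continuous_intros cf; force)+
  have int: "(\<lambda>y. k v s y * f y) integrable_on cbox \<alpha> \<beta>" if "v > 0" "s < T" for v s
    using that f by (intro integrable_continuous continuous_intros cont_y) (auto intro: continuous_on_subset)
  have int_V: "fV v integrable_on cbox \<alpha> \<beta>" if "v > 0" for v
    unfolding fV_def using that f t
    by (intro integrable_continuous continuous_intros cont_y) (auto intro: continuous_on_subset)
  have int_VV: "fVV v integrable_on cbox \<alpha> \<beta>" if "v > 0" for v
    unfolding fVV_def using that f t \<sigma>
    by (intro integrable_continuous continuous_intros cont_y) (auto intro: continuous_on_subset)
  have int_t: "ft t integrable_on cbox \<alpha> \<beta>"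
    unfolding ft_def using V f t \<sigma>
    by (intro integrable_continuous continuous_intros cont_y) (auto intro: continuous_on_subset)
  have "((\<lambda>s. integral (cbox \<alpha> \<beta>) (\<lambda>y. k V s y * f y)) has_real_derivative integral (cbox \<alpha> \<beta>) (ft t))
      (at t within {..<T})"
  proof (rule leibniz_rule_field_derivative[OF _ _ cont_t])
    fix s y assume "s \<in> {..<T}"
    then show "((\<lambda>s. k V s y * f y) has_real_derivative ft s y) (at s within {..<T})"
      unfolding ft_def k_def z_def by (intro has_field_derivative_at_within[OF DERIV_cmult_right[OF bs_kernel_has_derivative_t]] \<sigma>) simp
  qed (use int V t in auto)
  then have 1: "((\<lambda>s. F V s) has_real_derivative integral {\<alpha>..\<beta>} (ft t)) (at t)"
    using t by (simp add: k_eq at_within_open_NO_MATCH)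
  have 2: "((\<lambda>v. F v t) has_real_derivative integral {\<alpha>..\<beta>} (fV v)) (at v)" if v: "v > 0" for v
  proof -
    have "((\<lambda>v. integral (cbox \<alpha> \<beta>) (\<lambda>y. k v t y * f y)) has_real_derivative integral (cbox \<alpha> \<beta>) (fV v))
        (at v within {0<..})"
    proof (rule leibniz_rule_field_derivative[OF _ _ cont_V])
      fix v y :: real assume "v \<in> {0<..}"
      then show "((\<lambda>v. k v t y * f y) has_real_derivative fV v y) (at v within {0<..})"
        unfolding fV_def k_def z_def by (intro has_field_derivative_at_within[OF DERIV_cmult_right[OF bs_kernel_has_derivative_V]] \<sigma> t) simp
    qed (use int v t in auto)
    then show ?thesis
      using v by (simp add: k_eq at_within_open_NO_MATCH)
  qed
  have "((\<lambda>v. integral (cbox \<alpha> \<beta>) (fV v)) has_real_derivative integral (cbox \<alpha> \<beta>) (fVV V))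
      (at V within {0<..})"
  proof (rule leibniz_rule_field_derivative[OF _ _ cont_VV])
    fix v y :: real assume "v \<in> {0<..}"
    then show "((\<lambda>v. fV v y) has_real_derivative fVV v y) (at v within {0<..})"
      unfolding fV_def fVV_def k_def z_def by (intro has_field_derivative_at_within[OF DERIV_cmult_right[OF bs_kernel_has_derivative_VV]] \<sigma> t) simp
  qed (use int_V V in auto)
  then have 3: "((\<lambda>v. integral {\<alpha>..\<beta>} (fV v)) has_real_derivative integral {\<alpha>..\<beta>} (fVV V)) (at V)"
    using V by (simp add: at_within_open_NO_MATCH)
  \<comment> \<open>The pointwise equation, with \<open>Z\<close> the score: the terms in
    \<open>Z\<^sup>2\<close>, in \<open>Z\<close>, in \<open>1 / \<tau>\<close> and in
    \<open>r\<close> cancel separately.\<close>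
  have alg: "K * (r + 1 / (2 * \<tau>) - (r - q - S / 2) * Z - S / 2 * Z\<^sup>2) * g
      + 1/2 * S * V\<^sup>2 * (K * (Z\<^sup>2 - Z - 1 / (S * \<tau>)) / V\<^sup>2 * g) + (r - q) * V * (K * Z / V * g) - r * (K * g) = 0"
    if "S > 0" "\<tau> > 0" for K Z S \<tau> g
  proof -
    have e1: "1/2 * S * V\<^sup>2 * (K * (Z\<^sup>2 - Z - 1 / (S * \<tau>)) / V\<^sup>2 * g)
        = K * (S / 2 * Z\<^sup>2 - S / 2 * Z - 1 / (2 * \<tau>)) * g"
      using that V by (simp add: field_simps)
    have e2: "(r - q) * V * (K * Z / V * g) = K * ((r - q) * Z) * g"
      using V by simp
    show ?thesis unfolding e1 e2 by (simp add: algebra_simps)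
  qed
  have "((\<lambda>y. ft t y + 1/2 * \<sigma>\<^sup>2 * V\<^sup>2 * fVV V y + (r - q) * V * fV V y - r * (k V t y * f y)) has_integral
    integral (cbox \<alpha> \<beta>) (ft t) + 1/2 * \<sigma>\<^sup>2 * V\<^sup>2 * integral (cbox \<alpha> \<beta>) (fVV V)
      + (r - q) * V * integral (cbox \<alpha> \<beta>) (fV V) - r * integral (cbox \<alpha> \<beta>) (\<lambda>y. k V t y * f y)) (cbox \<alpha> \<beta>)"
    using int[OF V t] int_V[OF V] int_VV[OF V] int_t
    by (intro has_integral_add has_integral_diff has_integral_mult_right integrable_integral)
  moreover have "ft t y + 1/2 * \<sigma>\<^sup>2 * V\<^sup>2 * fVV V y + (r - q) * V * fV V y - r * (k V t y * f y) = 0" for y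
    unfolding ft_def fVV_def fV_def using t \<sigma> by (intro alg) auto
  ultimately have "((\<lambda>y. 0) has_integral
    integral (cbox \<alpha> \<beta>) (ft t) + 1/2 * \<sigma>\<^sup>2 * V\<^sup>2 * integral (cbox \<alpha> \<beta>) (fVV V)
      + (r - q) * V * integral (cbox \<alpha> \<beta>) (fV V) - r * integral (cbox \<alpha> \<beta>) (\<lambda>y. k V t y * f y)) (cbox \<alpha> \<beta>)"
    by (simp only:)
  from has_integral_unique[OF this has_integral_0]
  have 4: "integral {\<alpha>..\<beta>} (ft t) + 1/2 * \<sigma>\<^sup>2 * V\<^sup>2 * integral {\<alpha>..\<beta>} (fVV V)
      + (r - q) * V * integral {\<alpha>..\<beta>} (fV V) - r * F V t = 0"
    by (simp only: k_eq box_real)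
  show ?thesis
    by (rule exI[of _ "integral {\<alpha>..\<beta>} (ft t)"], rule exI[of _ "\<lambda>v. integral {\<alpha>..\<beta>} (fV v)"],
        rule exI[of _ "integral {\<alpha>..\<beta>} (fVV V)"]) (intro conjI allI impI 1 2 3 4)
qed

section \<open>The knock-out put\<close>

locale knockout_put =
  fixes r q a \<sigma> b R T T1 E K :: real
  assumes \<sigma>_pos: "\<sigma> > 0" and b_pos: "b > 0" and T1_less_T: "T1 < T"
    and K_ge: "K \<ge> Vb a b T T1"
begin

section \<open>Log-distance coordinates and the payoff\<close>

definition \<mu> :: real where "\<mu> = r - q - a - \<sigma>\<^sup>2 / 2"

definition \<gamma> :: real where "\<gamma> = 1 - 2 * (r - q - a) / \<sigma>\<^sup>2"

definition k :: real where "k = ln (K / Vb a b T T1)"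

definition X :: "real \<Rightarrow> real \<Rightarrow> real" where "X V t = ln (V / Vb a b T t)"

text \<open>The probability that the drifted Brownian motion, at \<open>y\<close> at time
  \<open>T1\<close>, is positive at \<open>T\<close>, absorption being ignored. Survival above the
  barrier also needs the image term that appears in \<open>payoff\<close>.\<close>

definition surv :: "real \<Rightarrow> real" where
  "surv y = Nd ((y + \<mu> * (T - T1)) / (\<sigma> * sqrt (T - T1)))"

text \<open>\<open>C1\<close> is the strike less the value at \<open>T1\<close> of the certain
  recovery; \<open>C2\<close> below is the value at \<open>T1\<close> of the part of the face amount
  paid only on survival.\<close>

definition C1 :: real where "C1 = E - R * exp (- r * (T - T1))"

definition C2 :: real where "C2 = (1 - R) * exp (- r * (T - T1))"

definition payoff :: "real \<Rightarrow> real" where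
  "payoff y = C1 - C2 * (surv y - exp (\<gamma> * y) * surv (- y))"

text \<open>The method of images: the weight \<open>exp (\<gamma> * y)\<close> makes the extended
  data antisymmetric under the weighted reflection that preserves the drifted kernel.\<close>

definition image_payoff :: "real \<Rightarrow> real" where
  "image_payoff y = - exp (\<gamma> * y) * payoff (- y)"

definition dens :: "real \<Rightarrow> real \<Rightarrow> real \<Rightarrow> real" where
  "dens x \<tau> = normal_density (x + \<mu> * \<tau>) (\<sigma> * sqrt \<tau>)"

text \<open>Identifies the exponent of the closed formula with that of
  \<open>normal_density_reflect\<close>.\<close>

lemma \<gamma>_eq: "\<gamma> = - 2 * \<mu> / \<sigma>\<^sup>2"
  using \<sigma>_pos by (simp add: \<gamma>_def \<mu>_def field_simps)

lemma Vb_pos: "Vb a b T t > 0"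
  using b_pos by (simp add: Vb_def)

lemma ln_Vb: "ln (Vb a b T t) = ln b - a * (T - t)"
  using b_pos by (simp add: Vb_def ln_mult)

lemma K_pos: "K > 0"
  using K_ge Vb_pos[of T1] by simp

lemma k_nonneg: "k \<ge> 0"
  unfolding k_def using K_ge Vb_pos[of T1] by simp

lemma X_eq: "V > 0 \<Longrightarrow> X V t = ln V - ln b + a * (T - t)"
  using Vb_pos[of t] by (simp add: X_def ln_div ln_Vb)

lemma k_eq: "k = ln K - ln b + a * (T - T1)"
  using Vb_pos[of T1] K_pos by (simp add: k_def ln_div ln_Vb)

lemma powr_\<gamma>: "V > 0 \<Longrightarrow> (V / Vb a b T t) powr \<gamma> = exp (\<gamma> * X V t)"
  using Vb_pos[of t] by (simp add: powr_def X_def)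

lemma continuous_on_surv [continuous_intros]:
  "continuous_on A f \<Longrightarrow> continuous_on A (\<lambda>x. surv (f x))"
  unfolding surv_def using \<sigma>_pos T1_less_T by (intro continuous_intros) auto

lemma continuous_on_payoff: "continuous_on A payoff"
  unfolding payoff_def by (intro continuous_intros)

lemma continuous_on_image_payoff: "continuous_on A image_payoff"
  unfolding image_payoff_def payoff_def by (intro continuous_intros)

text \<open>The slope \<open>a\<close> of the log-barrier is absorbed into the drift, so the
  numerators of \<open>d1\<close> and \<open>d2\<close> become \<open>X V T1\<close> and its
  negative, each plus \<open>\<mu> * (T - T1)\<close>.\<close>

lemma E_minus_Bbond:
  assumes "V > 0"
  shows "E - Bbond r q a \<sigma> b R T V T1 = payoff (X V T1)"
proof -
  have 1: "ln (V / b) + (r - q - \<sigma>\<^sup>2 / 2) * (T - T1) = X V T1 + \<mu> * (T - T1)"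
    using assms b_pos by (simp add: X_eq \<mu>_def ln_div algebra_simps)
  have 2: "ln (b / V) + (r - q - 2 * a - \<sigma>\<^sup>2 / 2) * (T - T1) = - X V T1 + \<mu> * (T - T1)"
    using assms b_pos by (simp add: X_eq \<mu>_def ln_div algebra_simps)
  show ?thesis
    unfolding Bbond_def Let_def 1 2 Vb_def[symmetric] \<gamma>_def[symmetric] powr_\<gamma>[OF assms]
      payoff_def C1_def C2_def surv_def by (simp add: algebra_simps)
qed

text \<open>For the drifted Brownian motion started at \<open>x\<close> at time \<open>t\<close>, \<open>G\<close> is the probability of
  \<open>X\<^bsub>T1\<^esub> \<in> (0, k)\<close>, and \<open>H\<close> that of \<open>X\<^bsub>T\<^esub> > 0\<close> together with \<open>\<bar>X\<^bsub>T1\<^esub>\<bar> < k\<close>.\<close>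
definition bnd :: "real \<Rightarrow> real \<Rightarrow> real \<Rightarrow> real" where
  "bnd \<tau> x c = (x + c + \<mu> * \<tau>) / (\<sigma> * sqrt \<tau>)"

definition G :: "real \<Rightarrow> real \<Rightarrow> real" where
  "G t x = Nd (bnd (T1 - t) x 0) - Nd (bnd (T1 - t) x (- k))"

definition H :: "real \<Rightarrow> real \<Rightarrow> real" where
  "H t x = (let \<rho> = sqrt ((T1 - t) / (T - t)); d = bnd (T - t) x 0; \<beta> = bnd (T1 - t) x in
     N2 d (\<beta> 0) \<rho> - N2 d (\<beta> (- k)) \<rho> + (N2 d (- \<beta> 0) (- \<rho>) - N2 d (- \<beta> k) (- \<rho>)))"

section \<open>From the closed formula to integrals against the Gaussian kernel\<close>

text \<open>Each quantity with a tilde is its plain counterpart with \<open>x = X V t\<close>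
  replaced by \<open>- x\<close>, and every argument is a \<open>bnd\<close> with shift
  \<open>0\<close>, \<open>k\<close> or \<open>- k\<close>.\<close>

lemma Pput_eq_reflection:
  assumes "V > 0"
  shows "Pput r q a \<sigma> b R T T1 E K V t = exp (- r * (T1 - t)) *
    (C1 * (G t (X V t) - exp (\<gamma> * X V t) * G t (- X V t))
      - C2 * (H t (X V t) - exp (\<gamma> * X V t) * H t (- X V t)))"
proof -
  define x where "x = X V t"
  \<comment> \<open>\<open>K\<close> is measured against the barrier at \<open>T1\<close> and
    \<open>V\<close> against the one at \<open>t\<close>. The discrepancy
    \<open>a * (T1 - t)\<close> accounts for the different drifts written in \<open>b2\<close> and
    \<open>tb5\<close>.\<close>
  have "ln (V / K) = x - k - a * (T1 - t)"
    using assms K_pos by (simp add: x_def X_eq k_eq ln_div algebra_simps)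
  then have b2: "ln (V / K) + (r - q - \<sigma>\<^sup>2 / 2) * (T1 - t) = x + - k + \<mu> * (T1 - t)"
    by (simp add: \<mu>_def algebra_simps)
  have "ln (K / V) = - x + k + a * (T1 - t)"
    using assms K_pos by (simp add: x_def X_eq k_eq ln_div algebra_simps)
  then have tb5: "ln (K / V) + (r - q - 2 * a - \<sigma>\<^sup>2 / 2) * (T1 - t) = - x + k + \<mu> * (T1 - t)"
    by (simp add: \<mu>_def algebra_simps)
  have vx: "ln (Vb a b T t / V) = - x"
    using assms Vb_pos[of t] by (simp add: x_def X_def ln_div)
  have "ln (Vb a b T T1 / K * (Vb a b T t / V)) = ln (Vb a b T T1 / K) + ln (Vb a b T t / V)"
    using assms Vb_pos[of t] Vb_pos[of T1] K_pos by (intro ln_mult_pos) auto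
  also have "ln (Vb a b T T1 / K) = - k"
    using Vb_pos[of T1] K_pos by (simp add: k_def ln_div)
  finally have kx: "ln (Vb a b T T1 / K * (Vb a b T t / V)) = - x + - k"
    by (simp add: vx)
  have kx': "- (- x + - k) = x + k" by simp
  have disc: "exp (- r * (T - t)) = exp (- r * (T1 - t)) * exp (- r * (T - T1))"
    by (simp add: exp_add[symmetric] algebra_simps)
  have x0: "ln (V / Vb a b T t) = x + 0" "ln (Vb a b T t / V) = - x + 0"
    by (simp_all add: x_def X_def[symmetric] vx[unfolded x_def])
  show ?thesis
    unfolding Pput_def Let_def Vb_def[of a b T t, symmetric] Vb_def[of a b T T1, symmetric] kx b2 tb5 \<gamma>_def[symmetric] powr_\<gamma>[OF assms] disc
    unfolding kx' x0 \<mu>_def[symmetric] bnd_def[symmetric] x_def[symmetric] G_def H_def Let_def C1_def C2_def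
    by (simp add: algebra_simps)
qed

lemma G_eq_integral:
  assumes "t < T1"
  shows "G t x = integral {0..k} (dens x (T1 - t))"
proof -
  define s where "s = \<sigma> * sqrt (T1 - t)"
  have s: "s > 0" using assms \<sigma>_pos by (simp add: s_def)
  have "G t x = integral {bnd (T1 - t) x (- k)..bnd (T1 - t) x 0} std_normal_density"
    unfolding G_def using k_nonneg s
    by (intro Nd_diff) (simp add: bnd_def s_def[symmetric] divide_right_mono)
  then show ?thesis
    using integral_std_normal_density_affine[OF s k_nonneg, of "\<lambda>_. 1" "x + \<mu> * (T1 - t)"]
    by (simp add: bnd_def dens_def s_def[symmetric] algebra_simps)
qed

text \<open>The pair with correlation \<open>\<rho>\<close> covers positions in
  \<open>{0..k}\<close> at \<open>T1\<close>, the pair with \<open>- \<rho>\<close> those in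
  \<open>{- k..0}\<close>. This value of \<open>\<rho>\<close> turns the conditional probability
  into \<open>surv\<close>.\<close>

lemma H_eq_integral:
  assumes "t < T1"
  shows "H t x = integral {- k..k} (\<lambda>y. dens x (T1 - t) y * surv y)"
proof -
  define s where "s = \<sigma> * sqrt (T1 - t)"
  define \<rho> where "\<rho> = sqrt ((T1 - t) / (T - t))"
  define d where "d = bnd (T - t) x 0"
  define \<beta> where "\<beta> = bnd (T1 - t) x"
  define f where "f = (\<lambda>y. std_normal_density y * Nd ((d - \<rho> * y) / sqrt (1 - \<rho>\<^sup>2)))"
  have s: "s > 0" using assms \<sigma>_pos by (simp add: s_def)
  have \<rho>2: "\<rho>\<^sup>2 = (T1 - t) / (T - t)" using assms T1_less_T by (simp add: \<rho>_def)
  have \<rho>: "0 \<le> \<rho>" "\<rho> < 1" using assms T1_less_T by (auto simp: \<rho>_def)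
  have le: "\<beta> (- k) \<le> \<beta> 0" "\<beta> 0 \<le> \<beta> k"
    using k_nonneg s by (auto simp: \<beta>_def bnd_def s_def[symmetric] divide_right_mono)
  have "H t x = (N2 d (\<beta> 0) \<rho> - N2 d (\<beta> (- k)) \<rho>) + (N2 d (- \<beta> 0) (- \<rho>) - N2 d (- \<beta> k) (- \<rho>))"
    by (simp add: H_def Let_def \<rho>_def d_def \<beta>_def)
  also have "N2 d (\<beta> 0) \<rho> - N2 d (\<beta> (- k)) \<rho> = integral {\<beta> (- k)..\<beta> 0} f"
    unfolding f_def using \<rho> le by (intro N2_diff) auto
  \<comment> \<open>Changing the sign of the integration variable restores the correlation
    \<open>\<rho>\<close>, so the two ranges become adjacent and share one integrand.\<close>
  also have "N2 d (- \<beta> 0) (- \<rho>) - N2 d (- \<beta> k) (- \<rho>) = integral {- \<beta> k..- \<beta> 0} (\<lambda>y. f (- y))"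
    using N2_diff[of "- \<rho>" "- \<beta> k" "- \<beta> 0" d] \<rho> le by (simp add: f_def normal_density_def)
  also have "\<dots> = integral {\<beta> 0..\<beta> k} f"
    by (rule Henstock_Kurzweil_Integration.integral_reflect_real)
  also have "integral {\<beta> (- k)..\<beta> 0} f + integral {\<beta> 0..\<beta> k} f = integral {\<beta> (- k)..\<beta> k} f"
  proof (rule Henstock_Kurzweil_Integration.integral_combine)
    show "f integrable_on {\<beta> (- k)..\<beta> k}"
      unfolding f_def using \<rho>
      by (intro integrable_continuous_real continuous_intros) (auto simp: power2_eq_1_iff)
  qed (use le in auto)
  \<comment> \<open>The position at \<open>T1\<close> is
    \<open>x + \<mu> * (T1 - t) - s * y\<close>. Since
    \<open>1 - \<rho>\<^sup>2 = (T - T1) / (T - t)\<close>, only the deviation over the remaining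
    time is left in the denominator.\<close>
  also have "f = (\<lambda>y. std_normal_density y * surv (x + \<mu> * (T1 - t) - s * y))"
  proof
    fix y
    define u w where "u = sqrt (T - t)" and "w = sqrt (T - T1)"
    have uw: "u > 0" "w > 0" using assms T1_less_T by (auto simp: u_def w_def)
    have "1 - \<rho>\<^sup>2 = (T - T1) / (T - t)" using assms T1_less_T by (simp add: \<rho>2 field_simps)
    then have "sqrt (1 - \<rho>\<^sup>2) = w / u" by (simp add: u_def w_def real_sqrt_divide)
    moreover have "\<rho> * y = s * y / (\<sigma> * u)"
      using \<sigma>_pos by (simp add: \<rho>_def s_def u_def real_sqrt_divide)
    moreover have "d = (x + \<mu> * (T - t)) / (\<sigma> * u)" by (simp add: d_def bnd_def u_def)
    ultimately have "(d - \<rho> * y) / sqrt (1 - \<rho>\<^sup>2)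
        = ((x + \<mu> * (T - t)) / (\<sigma> * u) - s * y / (\<sigma> * u)) / (w / u)"
      by (simp only:)
    also have "\<dots> = (x + \<mu> * (T - t) - s * y) / (\<sigma> * w)"
      using uw \<sigma>_pos by (simp add: diff_divide_distrib[symmetric])
    also have "x + \<mu> * (T - t) - s * y = x + \<mu> * (T1 - t) - s * y + \<mu> * (T - T1)"
      by (simp add: algebra_simps)
    finally show "f y = std_normal_density y * surv (x + \<mu> * (T1 - t) - s * y)"
      by (simp add: f_def surv_def w_def)
  qed
  also have "integral {\<beta> (- k)..\<beta> k} (\<lambda>y. std_normal_density y * surv (x + \<mu> * (T1 - t) - s * y))
      = integral {- k..k} (\<lambda>y. dens x (T1 - t) y * surv y)"
    using integral_std_normal_density_affine[OF s, of "- k" k surv "x + \<mu> * (T1 - t)"] k_nonneg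
    by (simp add: \<beta>_def bnd_def dens_def s_def[symmetric] algebra_simps continuous_on_surv)
  finally show ?thesis .
qed

text \<open>A reflected starting point is traded for reflected data: substitute \<open>- y\<close>
  and apply \<open>normal_density_reflect\<close>.\<close>

lemma integral_dens_reflect:
  assumes "\<tau> > 0"
  shows "exp (\<gamma> * x) * integral {\<alpha>..\<beta>} (\<lambda>y. dens (- x) \<tau> y * f y)
    = integral {- \<beta>..- \<alpha>} (\<lambda>y. dens x \<tau> y * (exp (\<gamma> * y) * f (- y)))"
proof -
  have "exp (\<gamma> * x) * integral {\<alpha>..\<beta>} (\<lambda>y. dens (- x) \<tau> y * f y)
      = integral {\<alpha>..\<beta>} (\<lambda>y. exp (\<gamma> * x) * (dens (- x) \<tau> y * f y))"
    by simp
  also have "\<dots> = integral {- \<beta>..- \<alpha>} (\<lambda>y. exp (\<gamma> * x) * (dens (- x) \<tau> (- y) * f (- y)))"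
    by (rule Henstock_Kurzweil_Integration.integral_reflect_real[symmetric])
  also have "(\<lambda>y. exp (\<gamma> * x) * (dens (- x) \<tau> (- y) * f (- y))) = (\<lambda>y. dens x \<tau> y * (exp (\<gamma> * y) * f (- y)))"
    using normal_density_reflect[OF \<sigma>_pos assms, of \<mu> x]
    by (simp add: dens_def \<gamma>_eq mult.assoc[symmetric]) (simp add: mult.commute)
  finally show ?thesis .
qed

lemma Pput_eq_integral:
  assumes "t < T1" "V > 0"
  shows "Pput r q a \<sigma> b R T T1 E K V t = exp (- r * (T1 - t)) *
    (integral {0..k} (\<lambda>y. dens (X V t) (T1 - t) y * payoff y)
      + integral {- k..0} (\<lambda>y. dens (X V t) (T1 - t) y * image_payoff y))"
proof -
  define x \<tau> where "x = X V t" and "\<tau> = T1 - t"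
  have \<tau>: "\<tau> > 0" using assms by (simp add: \<tau>_def)
  define I where "I = (\<lambda>\<alpha> \<beta> f. integral {\<alpha>..\<beta>} (\<lambda>y. dens x \<tau> y * f y))"
  have ok: "(\<lambda>y. dens x \<tau> y * f y) integrable_on {\<alpha>..\<beta>}" if "continuous_on UNIV f" for f \<alpha> \<beta>
    unfolding dens_def using \<tau> \<sigma>_pos that
    by (intro integrable_continuous_real continuous_intros) (auto intro: continuous_on_subset)
  have comb: "I \<alpha> \<beta> (\<lambda>y. c * f y + c' * g y) = c * I \<alpha> \<beta> f + c' * I \<alpha> \<beta> g"
    if "continuous_on UNIV f" "continuous_on UNIV g" for f g \<alpha> \<beta> c c'
  proof -
    have "((\<lambda>y. c * (dens x \<tau> y * f y) + c' * (dens x \<tau> y * g y)) has_integral c * I \<alpha> \<beta> f + c' * I \<alpha> \<beta> g) {\<alpha>..\<beta>}"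
      unfolding I_def using that
      by (intro has_integral_add has_integral_mult_right integrable_integral ok)
    moreover have "(\<lambda>y. c * (dens x \<tau> y * f y) + c' * (dens x \<tau> y * g y)) = (\<lambda>y. dens x \<tau> y * (c * f y + c' * g y))"
      by (simp add: algebra_simps)
    ultimately show ?thesis by (simp add: I_def integral_unique)
  qed
  have split: "I (- k) k f = I (- k) 0 f + I 0 k f" if "continuous_on UNIV f" for f
    unfolding I_def using k_nonneg
    by (intro Henstock_Kurzweil_Integration.integral_combine[symmetric] ok that) auto
  \<comment> \<open>For \<open>y \<ge> 0\<close> this is the survival probability from
    \<open>T1\<close> to \<open>T\<close>. It satisfies
    \<open>exp (\<gamma> * y) * h (- y) = - h y\<close>, so it is its own image; this is why the
    bivariate terms range over all of \<open>{- k..k}\<close>.\<close>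
  define h where "h = (\<lambda>y. surv y - exp (\<gamma> * y) * surv (- y))"
  have h: "continuous_on UNIV h" unfolding h_def by (intro continuous_intros)
  have e: "continuous_on UNIV (\<lambda>y. exp (\<gamma> * y))" by (intro continuous_intros)
  have "G t x = I 0 k (\<lambda>_. 1)"
    using assms by (simp add: G_eq_integral I_def \<tau>_def)
  moreover have "exp (\<gamma> * x) * G t (- x) = I (- k) 0 (\<lambda>y. exp (\<gamma> * y))"
    using integral_dens_reflect[OF \<tau>, of x 0 k "\<lambda>_. 1"] assms by (simp add: G_eq_integral I_def \<tau>_def)
  moreover have "H t x - exp (\<gamma> * x) * H t (- x) = I (- k) k h"
  proof -
    have "H t x = I (- k) k surv"
      using assms by (simp add: H_eq_integral I_def \<tau>_def)
    moreover have "exp (\<gamma> * x) * H t (- x) = I (- k) k (\<lambda>y. exp (\<gamma> * y) * surv (- y))"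
      using integral_dens_reflect[OF \<tau>, of x "- k" k surv] assms by (simp add: H_eq_integral I_def \<tau>_def)
    ultimately show ?thesis
      using comb[of surv "\<lambda>y. exp (\<gamma> * y) * surv (- y)" "- k" k 1 "- 1"]
      by (simp add: h_def continuous_intros)
  qed
  ultimately have "Pput r q a \<sigma> b R T T1 E K V t = exp (- r * (T1 - t)) *
      (C1 * (I 0 k (\<lambda>_. 1) - I (- k) 0 (\<lambda>y. exp (\<gamma> * y))) - C2 * (I (- k) 0 h + I 0 k h))"
    using Pput_eq_reflection[OF assms(2), of t] split[OF h] by (simp add: x_def)
  also have "C1 * (I 0 k (\<lambda>_. 1) - I (- k) 0 (\<lambda>y. exp (\<gamma> * y))) - C2 * (I (- k) 0 h + I 0 k h)
      = (C1 * I 0 k (\<lambda>_. 1) + - C2 * I 0 k h) + (- C1 * I (- k) 0 (\<lambda>y. exp (\<gamma> * y)) + - C2 * I (- k) 0 h)"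
    by (simp add: algebra_simps)
  also have "C1 * I 0 k (\<lambda>_. 1) + - C2 * I 0 k h = I 0 k payoff"
    unfolding comb[OF continuous_on_const h, symmetric] by (simp add: payoff_def[abs_def] h_def)
  also have "- C1 * I (- k) 0 (\<lambda>y. exp (\<gamma> * y)) + - C2 * I (- k) 0 h = I (- k) 0 image_payoff"
  proof -
    have "- C1 * exp (\<gamma> * y) + - C2 * h y = image_payoff y" for y
      by (simp add: image_payoff_def payoff_def h_def algebra_simps exp_minus)
    then show ?thesis unfolding comb[OF e h, symmetric] by simp
  qed
  finally show ?thesis by (simp add: I_def x_def \<tau>_def)
qed

section \<open>Boundary value, equation and terminal value\<close>

text \<open>On the barrier \<open>X\<close> is zero, so the weight is one and each term cancels with
  its reflection.\<close>

lemma Pput_boundary: "Pput r q a \<sigma> b R T T1 E K (Vb a b T t) t = 0"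
  using Pput_eq_reflection[OF Vb_pos, of t t] Vb_pos[of t] by (simp add: X_def)

text \<open>Returns to the price variable: \<open>y + ln (Vb a b T T1)\<close> is the log price at
  \<open>T1\<close>. The range and the weights no longer depend on \<open>V\<close> or
  \<open>t\<close>, so only the kernel has to be differentiated.\<close>

lemma Pput_eq_bs_kernel_integral:
  assumes "t < T1" "V > 0"
  shows "Pput r q a \<sigma> b R T T1 E K V t =
    integral {0..k} (\<lambda>y. bs_kernel r q \<sigma> T1 (y + ln (Vb a b T T1)) V t * payoff y)
    + integral {- k..0} (\<lambda>y. bs_kernel r q \<sigma> T1 (y + ln (Vb a b T T1)) V t * image_payoff y)"
proof -
  have "bs_kernel r q \<sigma> T1 (y + ln (Vb a b T T1)) V t = exp (- r * (T1 - t)) * dens (X V t) (T1 - t) y" for y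
  proof -
    have "y + ln (Vb a b T T1) - (ln V + (r - q - \<sigma>\<^sup>2 / 2) * (T1 - t)) = y - (X V t + \<mu> * (T1 - t))"
      using assms by (simp add: ln_Vb X_eq \<mu>_def algebra_simps)
    then show ?thesis
      unfolding bs_kernel_eq_normal_density[OF \<sigma>_pos assms(1)] dens_def normal_density_def by (simp only:)
  qed
  then show ?thesis
    by (simp add: Pput_eq_integral[OF assms] distrib_left mult.assoc)
qed

text \<open>By linearity the direct and image integrals are treated separately. Their sum equals the
  price on the open ranges \<open>s < T1\<close> and \<open>v > 0\<close>, which transfers the
  derivatives.\<close>

lemma Pput_solves:
  assumes "t < T1" "V > 0"
  defines "P \<equiv> Pput r q a \<sigma> b R T T1 E K"
  shows "\<exists>Pt PV PVV.
    ((\<lambda>s. P V s) has_real_derivative Pt) (at t) \<and>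
    ((\<lambda>v. P v t) has_real_derivative PV) (at V) \<and>
    (\<forall>\<^sub>F v in nhds V. (\<lambda>w. P w t) differentiable (at v)) \<and>
    (deriv (\<lambda>w. P w t) has_real_derivative PVV) (at V) \<and>
    Pt + 1/2 * \<sigma>\<^sup>2 * V\<^sup>2 * PVV + (r - q) * V * PV - r * P V t = 0"
proof -
  define F where "F = (\<lambda>\<alpha> \<beta> f V t. integral {\<alpha>..\<beta>} (\<lambda>y. bs_kernel r q \<sigma> T1 (y + ln (Vb a b T T1)) V t * f y))"
  have P_eq: "P v s = F 0 k payoff v s + F (- k) 0 image_payoff v s" if "v > 0" "s < T1" for v s
    using Pput_eq_bs_kernel_integral that by (simp add: P_def F_def)
  have solves: "\<exists>Ft FV FVV. ((\<lambda>s. F \<alpha> \<beta> f V s) has_real_derivative Ft) (at t) \<and>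
      (\<forall>v>0. ((\<lambda>v. F \<alpha> \<beta> f v t) has_real_derivative FV v) (at v)) \<and>
      (FV has_real_derivative FVV) (at V) \<and>
      Ft + 1/2 * \<sigma>\<^sup>2 * V\<^sup>2 * FVV + (r - q) * V * FV V - r * F \<alpha> \<beta> f V t = 0"
    if "continuous_on UNIV f" for \<alpha> \<beta> f
    unfolding F_def by (rule bs_kernel_integral_solves[OF \<sigma>_pos that assms(2,1)])
  obtain Ft FV FVV where F:
    "((\<lambda>s. F 0 k payoff V s) has_real_derivative Ft) (at t)"
    "\<forall>v>0. ((\<lambda>v. F 0 k payoff v t) has_real_derivative FV v) (at v)"
    "(FV has_real_derivative FVV) (at V)"
    "Ft + 1/2 * \<sigma>\<^sup>2 * V\<^sup>2 * FVV + (r - q) * V * FV V - r * F 0 k payoff V t = 0"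
    using solves[OF continuous_on_payoff, of 0 k] by (elim exE conjE)
  obtain Jt JV JVV where J:
    "((\<lambda>s. F (- k) 0 image_payoff V s) has_real_derivative Jt) (at t)"
    "\<forall>v>0. ((\<lambda>v. F (- k) 0 image_payoff v t) has_real_derivative JV v) (at v)"
    "(JV has_real_derivative JVV) (at V)"
    "Jt + 1/2 * \<sigma>\<^sup>2 * V\<^sup>2 * JVV + (r - q) * V * JV V - r * F (- k) 0 image_payoff V t = 0"
    using solves[OF continuous_on_image_payoff, of "- k" 0] by (elim exE conjE)
  have t: "((\<lambda>s. P V s) has_real_derivative Ft + Jt) (at t)"
    by (rule has_field_derivative_transform_within_open[OF DERIV_add[OF F(1) J(1)], of "{..<T1}"])
      (use assms P_eq in auto)
  have V: "((\<lambda>v. P v t) has_real_derivative FV v + JV v) (at v)" if "v > 0" for v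
    by (rule has_field_derivative_transform_within_open[OF DERIV_add[OF F(2)[rule_format] J(2)[rule_format]], of v "{0<..}"])
      (use assms that P_eq in auto)
  have ev: "\<forall>\<^sub>F v in nhds V. (\<lambda>w. P w t) differentiable (at v)"
    using eventually_nhds_in_open[of "{0<..}" V] assms(2)
    by (auto elim!: eventually_mono simp: real_differentiable_def intro: V)
  have VV: "(deriv (\<lambda>w. P w t) has_real_derivative FVV + JVV) (at V)"
    by (rule has_field_derivative_transform_within_open[OF DERIV_add[OF F(3) J(3)], of "{0<..}"])
      (use assms(2) in \<open>auto simp: DERIV_imp_deriv[OF V]\<close>)
  have "(Ft + Jt) + 1/2 * \<sigma>\<^sup>2 * V\<^sup>2 * (FVV + JVV) + (r - q) * V * (FV V + JV V) - r * P V t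
      = (Ft + 1/2 * \<sigma>\<^sup>2 * V\<^sup>2 * FVV + (r - q) * V * FV V - r * F 0 k payoff V t)
        + (Jt + 1/2 * \<sigma>\<^sup>2 * V\<^sup>2 * JVV + (r - q) * V * JV V - r * F (- k) 0 image_payoff V t)"
    unfolding P_eq[OF assms(2,1)] by (simp add: algebra_simps add_divide_distrib)
  also have "\<dots> = 0" by (simp only: F(4) J(4))
  finally show ?thesis using t V[OF assms(2)] ev VV by blast
qed

text \<open>Along any admissible sequence the kernel's mean tends to \<open>x = X V T1 > 0\<close>
  and its deviation to zero. The threshold property of \<open>K\<close> determines the sign of the
  payoff on either side of \<open>k\<close>.\<close>

lemma Pput_terminal:
  assumes V: "V > Vb a b T T1"
    and below: "\<And>V. Vb a b T T1 < V \<Longrightarrow> V < K \<Longrightarrow> Bbond r q a \<sigma> b R T V T1 < E"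
    and above: "\<And>V. Vb a b T T1 < V \<Longrightarrow> V \<ge> K \<Longrightarrow> Bbond r q a \<sigma> b R T V T1 \<ge> E"
  shows "((\<lambda>(v, s). Pput r q a \<sigma> b R T T1 E K v s) \<longlongrightarrow> pos_part (E - Bbond r q a \<sigma> b R T V T1))
    (at (V, T1) within {(v, s). 0 \<le> s \<and> s < T1 \<and> v > Vb a b T s})"
  unfolding tendsto_at_iff_sequentially
proof (intro allI impI)
  fix Z :: "nat \<Rightarrow> real \<times> real"
  assume Z: "\<forall>i. Z i \<in> {(v, s). 0 \<le> s \<and> s < T1 \<and> v > Vb a b T s} - {(V, T1)}" and lim: "Z \<longlonglongrightarrow> (V, T1)"
  define v s where "v = (\<lambda>i. fst (Z i))" and "s = (\<lambda>i. snd (Z i))"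
  have v: "v i > 0" for i
  proof -
    have "v i > Vb a b T (s i)" using Z[rule_format, of i] by (auto simp: v_def s_def)
    then show ?thesis using Vb_pos[of "s i"] by simp
  qed
  have s: "s i < T1" for i using Z[rule_format, of i] by (auto simp: s_def)
  have lv: "v \<longlonglongrightarrow> V" and ls: "s \<longlonglongrightarrow> T1"
    using tendsto_fst[OF lim] tendsto_snd[OF lim] by (simp_all add: v_def s_def)
  have V0: "V > 0" using V Vb_pos[of T1] by simp
  define x where "x = X V T1"
  have x: "x > 0" unfolding x_def X_def using V Vb_pos[of T1] by simp
  have "(\<lambda>i. X (v i) (s i) + \<mu> * (T1 - s i)) \<longlonglongrightarrow> X V T1 + \<mu> * (T1 - T1)"
    using v V0 by (simp only: X_eq) (intro tendsto_intros lv ls; simp)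
  then have m: "(\<lambda>i. X (v i) (s i) + \<mu> * (T1 - s i)) \<longlonglongrightarrow> x" by (simp add: x_def)
  have "(\<lambda>i. \<sigma> * sqrt (T1 - s i)) \<longlonglongrightarrow> \<sigma> * sqrt (T1 - T1)"
    by (intro tendsto_intros ls)
  then have sd: "(\<lambda>i. \<sigma> * sqrt (T1 - s i)) \<longlonglongrightarrow> 0" by simp
  have sd': "\<sigma> * sqrt (T1 - s i) > 0" for i using s \<sigma>_pos by simp
  \<comment> \<open>Every positive log-distance comes from a price above the barrier, so the
    hypotheses on the bond become sign conditions on \<open>payoff\<close>.\<close>
  have V_of: "\<exists>W. Vb a b T T1 < W \<and> X W T1 = y \<and> (W < K \<longleftrightarrow> y < k) \<and> E - Bbond r q a \<sigma> b R T W T1 = payoff y"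
    if "y > 0" for y
  proof -
    define W where "W = exp y * Vb a b T T1"
    have W: "W > Vb a b T T1" "X W T1 = y"
      using that Vb_pos[of T1] by (simp_all add: W_def X_def)
    have "W < K \<longleftrightarrow> exp y < K / Vb a b T T1"
      using Vb_pos[of T1] by (simp add: W_def field_simps)
    also have "\<dots> \<longleftrightarrow> y < k"
      unfolding k_def using Vb_pos[of T1] K_pos by (metis divide_pos_pos exp_ln exp_less_cancel_iff)
    finally show ?thesis
      using W E_minus_Bbond[of W] Vb_pos[of T1] by (intro exI[of _ W]) auto
  qed
  have pos: "payoff y > 0" if "y > 0" "y < k" for y
    using V_of[OF that(1)] below that(2) by force
  have neg: "payoff y \<le> 0" if "y > 0" "y \<ge> k" for y
    using V_of[OF that(1)] above that(2) by force
  \<comment> \<open>Positivity on \<open>(0, k)\<close> and continuity from the left give the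
    missing inequality.\<close>
  have at_k: "payoff x = 0" if "x = k"
  proof (rule antisym)
    show "payoff x \<le> 0" using neg x that by simp
    have "continuous (at_left x) payoff"
      using continuous_on_payoff[of UNIV] continuous_at_imp_continuous_at_within
      by (auto simp: continuous_on_eq_continuous_at)
    then have "(payoff \<longlongrightarrow> payoff x) (at_left x)" by (simp add: continuous_within)
    moreover have "\<forall>\<^sub>F y in at_left x. payoff y \<ge> 0"
      using eventually_at_left[OF x] pos that x by (auto intro!: exI[of _ 0] less_imp_le)
    ultimately show "0 \<le> payoff x" by (rule tendsto_lowerbound) simp
  qed
  \<comment> \<open>As \<open>x > 0\<close>, the only endpoint that \<open>x\<close> can meet is
    \<open>k\<close>, where \<open>at_k\<close> supplies the required zero.\<close>
  have "(\<lambda>i. exp (- r * (T1 - s i)) *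
      (integral {0..k} (\<lambda>y. dens (X (v i) (s i)) (T1 - s i) y * payoff y)
      + integral {- k..0} (\<lambda>y. dens (X (v i) (s i)) (T1 - s i) y * image_payoff y)))
    \<longlonglongrightarrow> exp (- r * (T1 - T1)) * (indicator {0..k} x * payoff x + indicator {- k..0} x * image_payoff x)"
    unfolding dens_def using x k_nonneg at_k
    by (intro tendsto_mult tendsto_add tendsto_intros ls
        normal_density_Icc_integral_tendsto m sd sd' continuous_on_payoff continuous_on_image_payoff) auto
  \<comment> \<open>The image term drops out because \<open>x > 0\<close>. Below \<open>k\<close>
    the payoff is positive and kept, above \<open>k\<close> it is nonpositive and cut off, and at
    \<open>k\<close> it is zero.\<close>
  also have "exp (- r * (T1 - T1)) * (indicator {0..k} x * payoff x + indicator {- k..0} x * image_payoff x)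
      = pos_part (E - Bbond r q a \<sigma> b R T V T1)"
    unfolding E_minus_Bbond[OF V0] x_def[symmetric] pos_part_def
    using x pos[OF x] neg[OF x] at_k by (cases x k rule: linorder_cases) auto
  finally show "((\<lambda>(v, s). Pput r q a \<sigma> b R T T1 E K v s) \<circ> Z)
      \<longlonglongrightarrow> pos_part (E - Bbond r q a \<sigma> b R T V T1)"
    using Pput_eq_integral[OF s v] by (simp add: o_def case_prod_beta v_def s_def)
qed

end

theorem theorem4:
  fixes r q a \<sigma> b R T T1 E K :: real
  assumes "\<sigma> > 0" and "b > 0" and "0 \<le> R" and "R < 1"
    and "0 < T1" and "T1 < T"
    and "exp (- r * (T - T1)) * R < E" and "E < exp (- r * (T - T1))"
    and "K \<ge> Vb a b T T1"
    and "\<And>V. Vb a b T T1 < V \<Longrightarrow> V < K \<Longrightarrow> Bbond r q a \<sigma> b R T V T1 < E"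
    and "\<And>V. Vb a b T T1 < V \<Longrightarrow> V \<ge> K \<Longrightarrow> Bbond r q a \<sigma> b R T V T1 \<ge> E"
  defines "P \<equiv> Pput r q a \<sigma> b R T T1 E K"
  shows
    "(\<forall>V t. 0 \<le> t \<and> t < T1 \<and> V > Vb a b T t \<longrightarrow>
        (\<exists>Pt PV PVV.
           ((\<lambda>s. P V s) has_real_derivative Pt) (at t) \<and>
           ((\<lambda>v. P v t) has_real_derivative PV) (at V) \<and>
           (\<forall>\<^sub>F v in nhds V. (\<lambda>w. P w t) differentiable (at v)) \<and>
           (deriv (\<lambda>w. P w t) has_real_derivative PVV) (at V) \<and>
           Pt + 1/2 * \<sigma>\<^sup>2 * V\<^sup>2 * PVV + (r - q) * V * PV - r * P V t = 0))
     \<and> (\<forall>t. 0 \<le> t \<and> t < T1 \<longrightarrow> P (Vb a b T t) t = 0)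
     \<and> (\<forall>V. V > Vb a b T T1 \<longrightarrow>
          ((\<lambda>(v, s). P v s) \<longlongrightarrow> pos_part (E - Bbond r q a \<sigma> b R T V T1))
            (at (V, T1) within {(v, s). 0 \<le> s \<and> s < T1 \<and> v > Vb a b T s}))"
proof -
  interpret knockout_put r q a \<sigma> b R T T1 E K
    by unfold_locales (use assms(1,2,6,9) in auto)
  have "V > 0" if "V > Vb a b T t" for V t
    using that Vb_pos[of t] by simp
  then show ?thesis
    unfolding P_def using Pput_solves Pput_boundary Pput_terminal[OF _ assms(10,11)] by blast
qed

end
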